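(* Suppose $(V,\mathcal{V})$ is a weighted voting system with $N$ voters, weights $w(v)=1$ for all $v\in V$ and (fixed) relative quota $r$. Let $v\in V$. 1. $$S_B(v)\to\frac12\quad\text{as } N\to\infty,$$ and for $r>\frac12$ $$S_B^+(v)\le\frac12\,e^{-2(r-\frac12)^2(N-1)}.$$ 2. $$S_S^+(v)\to\frac12-\frac12r^2\quad\text{as } N\to\infty,$$ $$S_S^-(v)\to\frac12-\frac12(1-r)^2\quad\text{as } N\to\infty.$$ Consequently $$S_S(v)\to1-\frac12\big(r^2+(1-r)^2\big)\quad\text{as } N\to\infty.$$
   Context: A weighted voting system with $N$ voters, all weights equal to $1$ and relative quota $r$ consists of a set $V$ with $|V|=N$ and the family $\mathcal{V}$ of winning coalitions $A\subset V$, where $A\in\mathcal{V}$ if and only if $|A|\ge rN$. By definition of a voting system, $V\in\mathcal{V}$ and $\emptyset\notin\mathcal{V}$, so $0<r\le1$. The relative quota $r$ is kept fixed as $N\to\infty$. The Penrose-Banzhaf measure on the power set $\mathcal{P}(V)$ is $\mathbb{P}_B(\mathcal{A})=|\mathcal{A}|/2^N$ for $\mathcal{A}\subset\mathcal{P}(V)$. The Shapley-Shubik measure $\mathbb{P}_S$ is the probability measure on $\mathcal{P}(V)$ giving each coalition $A$ with $|A|=k$ the probability $\mathbb{P}_S(A)=\frac{1}{N+1}\frac{1}{\binom Nk}$. For a probability measure $\mathbb{P}_\ast$ with $\ast\in\{B,S\}$: the rate of affirmative success of $v$ is $S_\ast^+(v)=\mathbb{P}_\ast(\{A\in\mathcal{V}\mid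 v\in A\})$, the rate of blocking success is $S_\ast^-(v)=\mathbb{P}_\ast(\{A\subset V\mid A\notin\mathcal{V}, v\notin A\})$, and the (total) rate of success is $S_\ast(v)=S_\ast^+(v)+S_\ast^-(v)$. *)

theory Defs
  imports "HOL-Probability.Probability"
begin

locale voting_system =
  fixes V :: "'a set" and \<V> :: "'a set set"
  assumes finite_voters: "finite V"
    and coalitions: "\<V> \<subseteq> Pow V"
    and grand_coalition_wins: "V \<in> \<V>"
    and empty_coalition_loses: "{} \<notin> \<V>"

text \<open>The quota \<open>r\<close> is relative to the total weight of all voters.
  The bounds on \<open>r\<close> are not assumed: they follow from the two axioms on
  \<open>V\<close> and \<open>{}\<close>, see \<open>unit_weights_quota\<close> below.\<close>

locale weighted_voting_system = voting_system V \<V>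
  for V :: "'a set" and \<V> :: "'a set set" +
  fixes w :: "'a \<Rightarrow> real" and r :: real
  assumes weights_nonneg: "u \<in> V \<Longrightarrow> 0 \<le> w u"
    and winning_iff: "A \<subseteq> V \<Longrightarrow> A \<in> \<V> \<longleftrightarrow> sum w A \<ge> r * sum w V"

lemma unit_weights_winning_iff:
  assumes "weighted_voting_system V \<V> (\<lambda>_. 1) r" and "A \<subseteq> V"
  shows "A \<in> \<V> \<longleftrightarrow> real (card A) \<ge> r * real (card V)"
  using weighted_voting_system.winning_iff[OF assms] by simp

lemma unit_weights_quota:
  assumes "weighted_voting_system V \<V> (\<lambda>_. 1) r"
  shows "0 < r" and "r \<le> 1"
proof -
  interpret weighted_voting_system V \<V> "\<lambda>_. 1" r by (rule assms)
  have "V \<noteq> {}"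
    using grand_coalition_wins empty_coalition_loses by auto
  then have pos: "0 < real (card V)"
    using finite_voters by (simp add: card_gt_0_iff)
  show "0 < r"
    using unit_weights_winning_iff[OF assms, of "{}"] empty_coalition_loses pos
    by (simp add: zero_less_mult_iff not_le)
  show "r \<le> 1"
    using unit_weights_winning_iff[OF assms, of V] grand_coalition_wins pos by simp
qed

lemma unit_weights_exists:
  assumes "finite V" and "V \<noteq> {}" and "0 < r" and "r \<le> 1"
  shows "weighted_voting_system V {A. A \<subseteq> V \<and> real (card A) \<ge> r * real (card V)} (\<lambda>_. 1) r"
  using assms
  by unfold_locales (auto simp: card_gt_0_iff mult_le_0_iff mult_left_le_one_le)

definition penrose_banzhaf :: "'a set \<Rightarrow> 'a set measure" where
  "penrose_banzhaf V = uniform_count_measure (Pow V)"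

definition shapley_shubik :: "'a set \<Rightarrow> 'a set measure" where
  "shapley_shubik V =
     point_measure (Pow V)
       (\<lambda>A. ennreal (1 / (real (card V) + 1) * (1 / real (card V choose card A))))"

lemma measure_penrose_banzhaf:
  assumes "finite V" and "\<A> \<subseteq> Pow V"
  shows "measure (penrose_banzhaf V) \<A> = real (card \<A>) / 2 ^ card V"
  using assms
  by (simp add: penrose_banzhaf_def measure_uniform_count_measure card_Pow)

lemma measure_shapley_shubik:
  assumes "finite V" and "\<A> \<subseteq> Pow V"
  shows "measure (shapley_shubik V) \<A> =
    (\<Sum>A\<in>\<A>. 1 / (real (card V) + 1) * (1 / real (card V choose card A)))"
proof -
  have "finite \<A>" using assms finite_subset by blast
  then show ?thesis using assms unfolding shapley_shubik_def measure_def
    by (subst emeasure_point_measure_finite) (auto simp: sum_nonneg)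
qed

text \<open>In the three rates, \<open>P\<close> is a measure on the power set of the set of voters \<open>V\<close>.\<close>

definition affirmative_success :: "'a set measure \<Rightarrow> 'a set set \<Rightarrow> 'a \<Rightarrow> real" where
  "affirmative_success P \<V> v = measure P {A \<in> \<V>. v \<in> A}"

definition blocking_success :: "'a set measure \<Rightarrow> 'a set \<Rightarrow> 'a set set \<Rightarrow> 'a \<Rightarrow> real" where
  "blocking_success P V \<V> v = measure P {A. A \<subseteq> V \<and> A \<notin> \<V> \<and> v \<notin> A}"

definition success :: "'a set measure \<Rightarrow> 'a set \<Rightarrow> 'a set set \<Rightarrow> 'a \<Rightarrow> real" where
  "success P V \<V> v = affirmative_success P \<V> v + blocking_success P V \<V> v"

end

theory Submission
  imports Defs
begin

text \<open>
  With unit weights a coalition wins iff it has at least \<open>t = \<lceil>r N\<rceil>\<close> members, so each rate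
  of success is a sum over coalition sizes. Coalitions containing the voter \<open>v\<close> correspond to
  subsets of the \<open>N - 1\<close> other voters by removing \<open>v\<close>.

  For the Penrose-Banzhaf measure, \<open>v\<close> is successful on the winning side when at least \<open>t - 1\<close>
  others agree, and on the losing side when at most \<open>t - 1\<close> others agree. The two sums cover the
  whole row of binomial coefficients and overlap only in the pivotal size \<open>t - 1\<close>; hence
  \<open>S\<^sub>B = 1/2 + binom(N - 1, t - 1) / 2\<^sup>N\<close> (\<open>success_penrose_banzhaf\<close>), and the
  second term vanishes because no binomial coefficient \<open>binom(m, j)\<close> exceeds \<open>2\<^sup>m / \<surd>m\<close> for \<open>m \<ge> 1\<close>
  (\<open>binomial_square_le\<close>).

  The exponential bound asks for a tail estimate for \<open>N - 1\<close> fair coins that is slightly sharper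
  than Hoeffding's inequality: at least \<open>t - 1\<close> heads among \<open>N - 1\<close> coins is a deviation of
  \<open>(t - 1)/(N - 1) - 1/2\<close>, whereas the exponent contains the deviation \<open>t/N - 1/2\<close>, which is
  larger for \<open>t < N\<close>. The sharper bound is proved by induction on the number of coins
  (\<open>binomial_tail_le\<close>): with \<open>u = 2 t - N\<close>, Pascal's rule replaces the pair \<open>(N, u)\<close> by
  \<open>(N - 1, u - 1)\<close> and \<open>(N - 1, u + 1)\<close>, and the Gaussian
  \<open>exp (- (N - 1) u\<^sup>2 / (2 N\<^sup>2))\<close> dominates the average of its two predecessors
  (\<open>gaussian_average_le\<close>).

  For the Shapley-Shubik measure the binomial coefficients cancel: coalitions of size \<open>k\<close>
  containing \<open>v\<close> have total probability \<open>k / (N (N + 1))\<close>, those not containing \<open>v\<close> have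
  \<open>(N - k) / (N (N + 1))\<close>. Both rates are therefore arithmetic sums, rational functions of
  \<open>t / N\<close> and \<open>1 / N\<close>, and \<open>t / N\<close> tends to \<open>r\<close>.
\<close>

section \<open>The tail of a symmetric binomial distribution\<close>

text \<open>
  This is the moment bound behind Hoeffding's lemma for a fair \<open>\<plusminus>1\<close> coin: the auxiliary
  estimate for a coin with success probability \<open>1/2\<close>, taken at \<open>2 y\<close>, is the claim after the
  factor \<open>exp y\<close> is cancelled.
\<close>

lemma cosh_le_exp_half_square: "cosh (x::real) \<le> exp (x\<^sup>2 / 2)"
proof -
  have "exp y + exp (- y) \<le> 2 * exp (y\<^sup>2 / 2)" if "y \<ge> 0" for y :: real
  proof -
    have pos: "1 + (exp (2 * y) - 1) / 2 > 0" by (simp add: add_pos_pos field_simps)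
    have "- (2 * y) * (1 / 2) + ln (1 + 1 / 2 * (exp (2 * y) - 1)) \<le> (2 * y)\<^sup>2 / 8"
      by (rule Hoeffdings_lemma_aux) (use that in auto)
    then have "ln (1 + (exp (2 * y) - 1) / 2) \<le> y\<^sup>2 / 2 + y" by simp
    then have "1 + (exp (2 * y) - 1) / 2 \<le> exp (y\<^sup>2 / 2 + y)" using pos
      by (metis exp_le_cancel_iff exp_ln)
    then have "(exp y + exp (-y)) / 2 * exp y \<le> exp (y\<^sup>2 / 2) * exp y"
      by (simp add: field_simps mult_exp_exp flip: exp_double power2_eq_square exp_add)
    then show ?thesis by simp
  qed
  from this[of "\<bar>x\<bar>"] have "cosh \<bar>x\<bar> \<le> exp (x\<^sup>2 / 2)"
    by (simp add: cosh_field_def)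
  then show ?thesis by simp
qed

text \<open>
  Averaging over \<open>u - 1\<close> and \<open>u + 1\<close> multiplies the Gaussian of variance \<open>1/k\<close> by
  \<open>exp (- k / 2) cosh (k u)\<close>, where \<open>k = (n - 1)/n\<^sup>2\<close>. Bounding \<open>cosh\<close> by
  \<open>exp ((k u)\<^sup>2 / 2)\<close> leaves a comparison of exponents which, cleared of denominators,
  reads \<open>u\<^sup>2 (n\<^sup>3 - n\<^sup>2 + 1) \<le> n\<^sup>2 (n - 1) (n + 1)\<^sup>2\<close>. In the
  difference of the exponents the coefficient of \<open>u\<^sup>2\<close> cancels up to order
  \<open>n\<^sup>-\<^sup>3\<close>, which is why this holds on the whole range \<open>\<bar>u\<bar> \<le> n\<close>; the polynomial
  inequality fails at \<open>u = n + 1\<close>.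
\<close>

lemma gaussian_average_le:
  fixes n u :: real
  assumes n: "n \<ge> 2" and u: "\<bar>u\<bar> \<le> n"
  shows "exp (- (n - 1) / n\<^sup>2 * (u - 1)\<^sup>2 / 2) + exp (- (n - 1) / n\<^sup>2 * (u + 1)\<^sup>2 / 2)
    \<le> 2 * exp (- n / (n + 1)\<^sup>2 * u\<^sup>2 / 2)"
proof -
  define k where "k = (n - 1) / n\<^sup>2"
  have usq: "u\<^sup>2 \<le> n\<^sup>2" using u n by (simp add: abs_le_square_iff[symmetric])
  have "u\<^sup>2 * (n^3 - n\<^sup>2 + 1) \<le> n\<^sup>2 * (n^3 - n\<^sup>2 + 1)"
  proof (rule mult_right_mono[OF usq])
    have "n^3 - n\<^sup>2 = n\<^sup>2 * (n - 1)" by (simp add: algebra_simps power3_eq_cube power2_eq_square)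
    then show "0 \<le> n^3 - n\<^sup>2 + 1" using n by simp
  qed
  also have "n\<^sup>2 * (n^3 - n\<^sup>2 + 1) \<le> n\<^sup>2 * ((n - 1) * (n + 1)\<^sup>2)"
  proof (rule mult_left_mono)
    have "n * 2 \<le> n * n" using n by (intro mult_left_mono) auto
    moreover have "(n - 1) * (n + 1)\<^sup>2 - (n^3 - n\<^sup>2 + 1) = 2 * (n * n) - n - 2"
      by (simp add: algebra_simps power3_eq_cube power2_eq_square)
    ultimately show "n^3 - n\<^sup>2 + 1 \<le> (n - 1) * (n + 1)\<^sup>2" using n by linarith
  qed simp
  finally have poly: "u\<^sup>2 * (n^3 - n\<^sup>2 + 1) \<le> n\<^sup>2 * (n - 1) * (n + 1)\<^sup>2" by (simp add: mult.assoc)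
  have gap: "k * (u\<^sup>2 + 1) - (k * u)\<^sup>2 - n / (n + 1)\<^sup>2 * u\<^sup>2
      = (n\<^sup>2 * (n - 1) * (n + 1)\<^sup>2 - u\<^sup>2 * (n^3 - n\<^sup>2 + 1)) / (n ^ 4 * (n + 1)\<^sup>2)"
  proof -
    have nonzero: "n ^ 4 * (n + 1)\<^sup>2 \<noteq> 0" using n by auto
    have k: "k * n\<^sup>2 = n - 1" and quot: "n / (n + 1)\<^sup>2 * (n + 1)\<^sup>2 = n"
      using n by (simp_all add: k_def)
    have "(k * (u\<^sup>2 + 1) - (k * u)\<^sup>2 - n / (n + 1)\<^sup>2 * u\<^sup>2) * (n ^ 4 * (n + 1)\<^sup>2)
      = (k * n\<^sup>2) * (u\<^sup>2 + 1) * n\<^sup>2 * (n + 1)\<^sup>2 - (k * n\<^sup>2)\<^sup>2 * u\<^sup>2 * (n + 1)\<^sup>2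
        - (n / (n + 1)\<^sup>2 * (n + 1)\<^sup>2) * u\<^sup>2 * n ^ 4"
      by algebra
    also have "\<dots> = (n - 1) * (u\<^sup>2 + 1) * n\<^sup>2 * (n + 1)\<^sup>2 - (n - 1)\<^sup>2 * u\<^sup>2 * (n + 1)\<^sup>2
        - n * u\<^sup>2 * n ^ 4"
      by (simp only: k quot)
    also have "\<dots> = n\<^sup>2 * (n - 1) * (n + 1)\<^sup>2 - u\<^sup>2 * (n^3 - n\<^sup>2 + 1)"
      by algebra
    finally show ?thesis by (rule nonzero_eq_divide_eq[OF nonzero, THEN iffD2])
  qed
  have key: "n / (n + 1)\<^sup>2 * u\<^sup>2 \<le> k * (u\<^sup>2 + 1) - (k * u)\<^sup>2"
  proof -
    have "0 \<le> (n\<^sup>2 * (n - 1) * (n + 1)\<^sup>2 - u\<^sup>2 * (n^3 - n\<^sup>2 + 1)) / (n ^ 4 * (n + 1)\<^sup>2)"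
      using poly by (intro divide_nonneg_nonneg) auto
    then show ?thesis unfolding gap[symmetric] by linarith
  qed
  have "exp (- k * (u - 1)\<^sup>2 / 2) + exp (- k * (u + 1)\<^sup>2 / 2)
      = 2 * (exp (- k * (u\<^sup>2 + 1) / 2) * cosh (k * u))"
  proof -
    have "- k * (u - 1)\<^sup>2 / 2 = - k * (u\<^sup>2 + 1) / 2 + k * u"
      "- k * (u + 1)\<^sup>2 / 2 = - k * (u\<^sup>2 + 1) / 2 + - (k * u)"
      by (simp_all add: power2_eq_square algebra_simps add_divide_distrib diff_divide_distrib)
    then show ?thesis by (simp only: exp_add cosh_field_def) (simp add: distrib_left)
  qed
  also have "\<dots> \<le> 2 * (exp (- k * (u\<^sup>2 + 1) / 2) * exp ((k * u)\<^sup>2 / 2))"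
    by (intro mult_left_mono cosh_le_exp_half_square) auto
  also have "\<dots> = 2 * exp (- (k * (u\<^sup>2 + 1) - (k * u)\<^sup>2) / 2)"
    by (simp add: mult_exp_exp add_divide_distrib diff_divide_distrib)
  also have "\<dots> \<le> 2 * exp (- n / (n + 1)\<^sup>2 * u\<^sup>2 / 2)"
    using key by simp
  finally show ?thesis by (simp only: k_def minus_divide_left)
qed

text \<open>
  The exponent is \<open>- 2 m ((j + 1)/(m + 1) - 1/2)\<^sup>2\<close>, written in terms of
  \<open>u = 2 (j + 1) - (m + 1)\<close>. Of the two ends of the range, \<open>u = 0\<close> is trivial because the
  bound is then \<open>2\<^sup>m\<close>, and \<open>j = m\<close> is a direct comparison of \<open>1\<close> with
  \<open>(2 / \<surd>e)\<^sup>m\<close>. In between, both predecessors of \<open>(m, j)\<close> in Pascal's triangle lie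
  in the range, and \<open>gaussian_average_le\<close> applies.
\<close>

lemma binomial_tail_le:
  assumes "j \<le> m" and "m \<le> 2 * j + 1"
  shows "(\<Sum>i=j..m. real (m choose i))
    \<le> 2 ^ m * exp (- real m / (real m + 1)\<^sup>2 * (2 * real j + 1 - real m)\<^sup>2 / 2)"
  using assms
proof (induction m arbitrary: j)
  case 0
  then show ?case by simp
next
  case (Suc m)
  consider "2 * j = m" | "j = Suc m" | "j \<noteq> 0" "m < 2 * j" "j \<le> m"
    using Suc.prems by fastforce
  then show ?case
  proof cases
    case 1
    \<comment> \<open>\<open>u = 0\<close>: the tail is bounded by the full row.\<close>
    have "(\<Sum>i=j..Suc m. real (Suc m choose i)) \<le> (\<Sum>i\<le>Suc m. real (Suc m choose i))"
      by (intro sum_mono2) auto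
    also have "\<dots> = 2 ^ Suc m"
      by (metis choose_row_sum of_nat_sum of_nat_power of_nat_numeral)
    finally have "(\<Sum>i=j..Suc m. real (Suc m choose i)) \<le> 2 ^ Suc m" .
    moreover have "2 * real j + 1 - real (Suc m) = 0" using 1 by linarith
    ultimately show ?thesis by simp
  next
    case 2
    \<comment> \<open>\<open>u = m + 2\<close>, just beyond the range of \<open>gaussian_average_le\<close>: the tail is one term.\<close>
    have "exp (real (Suc m) / 2) = exp (1 / 2) ^ Suc m"
      using exp_of_nat_mult[of "Suc m" "1 / 2 :: real"]
      by (simp only: mult_1_right times_divide_eq_right)
    also have "\<dots> \<le> 2 ^ Suc m"
    proof (rule power_mono)
      have "exp (1 / 2 :: real) \<le> 1 + 1 / 2 + (1 / 2)\<^sup>2" by (rule exp_bound) auto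
      then show "exp (1 / 2 :: real) \<le> 2" by (simp add: power2_eq_square)
    qed simp
    finally have "1 \<le> 2 ^ Suc m * exp (- (real (Suc m) / 2))"
      by (simp add: exp_minus field_simps)
    moreover have "- real (Suc m) / (real (Suc m) + 1)\<^sup>2 * (2 * real j + 1 - real (Suc m))\<^sup>2 / 2
        = - (real (Suc m) / 2)"
    proof -
      have "2 * real j + 1 - real (Suc m) = real (Suc m) + 1" using 2 by simp
      moreover have "(real (Suc m) + 1)\<^sup>2 \<noteq> 0" by (simp add: add_eq_0_iff)
      ultimately show ?thesis by (simp only: times_divide_eq_left nonzero_mult_div_cancel_right)
        (simp add: field_simps)
    qed
    moreover have "(\<Sum>i=j..Suc m. real (Suc m choose i)) = 1" using 2 by simp
    ultimately show ?thesis by (simp only:)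
  next
    case 3
    then obtain i where i: "j = Suc i" by (cases j) auto
    have "(\<Sum>k=j..Suc m. real (Suc m choose k)) = (\<Sum>k=i..m. real (Suc m choose Suc k))"
      unfolding i by (rule sum.shift_bounds_cl_Suc_ivl)
    also have "\<dots> = (\<Sum>k=i..m. real (m choose k)) + (\<Sum>k=i..m. real (m choose Suc k))"
      by (simp add: sum.distrib)
    also have "(\<Sum>k=i..m. real (m choose Suc k)) = (\<Sum>k=j..Suc m. real (m choose k))"
      unfolding i by (rule sum.shift_bounds_cl_Suc_ivl[symmetric])
    also have "\<dots> = (\<Sum>k=j..m. real (m choose k))"
      using 3 by simp
    also have "(\<Sum>k=i..m. real (m choose k)) + (\<Sum>k=j..m. real (m choose k)) \<le>
        2 ^ m * exp (- real m / (real m + 1)\<^sup>2 * (2 * real i + 1 - real m)\<^sup>2 / 2)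
        + 2 ^ m * exp (- real m / (real m + 1)\<^sup>2 * (2 * real j + 1 - real m)\<^sup>2 / 2)"
      using 3 i by (intro add_mono Suc.IH) auto
    also have "\<dots> = 2 ^ m * (exp (- (real (Suc m) - 1) / (real (Suc m))\<^sup>2 * ((2 * real j - real m) - 1)\<^sup>2 / 2)
        + exp (- (real (Suc m) - 1) / (real (Suc m))\<^sup>2 * ((2 * real j - real m) + 1)\<^sup>2 / 2))"
    proof -
      have "2 * real i + 1 - real m = (2 * real j - real m) - 1"
        "2 * real j + 1 - real m = (2 * real j - real m) + 1"
        "real m = real (Suc m) - 1" "real m + 1 = real (Suc m)"
        unfolding i by simp_all
      then show ?thesis by (simp only: distrib_left)
    qed
    also have "\<dots> \<le> 2 ^ m * (2 * exp (- real (Suc m) / (real (Suc m) + 1)\<^sup>2 * (2 * real j - real m)\<^sup>2 / 2))"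
      using 3 by (intro mult_left_mono gaussian_average_le) auto
    also have "2 * real j - real m = 2 * real j + 1 - real (Suc m)" by simp
    finally show ?thesis by (simp only: power_Suc mult.assoc mult.left_commute)
  qed
qed

section \<open>The size of a single binomial coefficient\<close>

text \<open>
  Passing from \<open>n\<close> to \<open>n + 1\<close> multiplies the left-hand side by
  \<open>4 (2 n + 1) (2 n + 3) / (n + 1)\<^sup>2\<close>, which is below \<open>16\<close> since
  \<open>(2 n + 1) (2 n + 3) < (2 n + 2)\<^sup>2\<close>.
\<close>

lemma central_binomial_square_le: "(2 * n + 1) * ((2 * n) choose n)\<^sup>2 \<le> 16 ^ n"
proof (induction n)
  case (Suc n)
  have "Suc n * ((2 * Suc n) choose Suc n) = 2 * (2 * n + 1) * ((2 * n) choose n)"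
  proof -
    have "Suc n * (2 * Suc n choose Suc n) = (2 * n + 2) * (2 * n + 1 choose n)"
      using Suc_times_binomial[of n "2 * n + 1"] by (simp add: algebra_simps)
    moreover have "Suc n * (2 * n + 1 choose n) = (2 * n + 1) * (2 * n choose n)"
      using Suc_times_binomial[of n "2 * n"] binomial_symmetric[of n "2 * n + 1"] by (simp add: algebra_simps)
    ultimately have "Suc n * (Suc n * (2 * Suc n choose Suc n)) = Suc n * (2 * (2 * n + 1) * ((2 * n) choose n))"
      by (simp add: algebra_simps)
    then show ?thesis by (metis mult_left_cancel nat.simps(3))
  qed
  note step = this
  have "(Suc n)\<^sup>2 * ((2 * Suc n + 1) * ((2 * Suc n) choose Suc n)\<^sup>2)
      = (2 * n + 3) * (Suc n * ((2 * Suc n) choose Suc n))\<^sup>2"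
  proof -
    have "2 * Suc n + 1 = 2 * n + 3" by simp
    then show ?thesis by (simp only: power_mult_distrib mult.left_commute)
  qed
  also have "\<dots> = (2 * n + 3) * (2 * (2 * n + 1) * ((2 * n) choose n))\<^sup>2"
    unfolding step ..
  also have "\<dots> = 4 * (2 * n + 3) * (2 * n + 1) * ((2 * n + 1) * ((2 * n) choose n)\<^sup>2)"
    by (simp add: power2_eq_square algebra_simps)
  also have "\<dots> \<le> 4 * (2 * n + 3) * (2 * n + 1) * 16 ^ n"
    by (intro mult_left_mono Suc) auto
  also have "\<dots> \<le> (Suc n)\<^sup>2 * 16 * 16 ^ n"
    by (intro mult_right_mono) (auto simp: power2_eq_square algebra_simps)
  finally have "(Suc n)\<^sup>2 * ((2 * Suc n + 1) * ((2 * Suc n) choose Suc n)\<^sup>2) \<le> (Suc n)\<^sup>2 * 16 ^ Suc n"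
    by simp
  then show ?case by simp
qed simp

text \<open>
  Every coefficient of an even row is at most the central one; a coefficient of an odd row is the
  sum of two coefficients of the even row above it.
\<close>

lemma binomial_square_le: "m * (m choose j)\<^sup>2 \<le> 4 ^ m"
proof -
  define n where "n = m div 2"
  have max: "(2 * n) choose i \<le> (2 * n) choose n" for i
    using binomial_maximum[of "2 * n" i] by simp
  consider "m = 2 * n" | "m = Suc (2 * n)" unfolding n_def by linarith
  then show ?thesis
  proof cases
    case 1
    have "m * (m choose j)\<^sup>2 \<le> (2 * n + 1) * ((2 * n) choose n)\<^sup>2"
      unfolding 1 by (intro mult_mono power_mono max) auto
    also have "\<dots> \<le> 16 ^ n" by (rule central_binomial_square_le)
    finally show ?thesis by (simp add: 1 power_mult)
  next
    case 2
    have "m choose j \<le> 2 * ((2 * n) choose n)"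
      using max[of j] max[of "j - 1"] unfolding 2 by (cases j) auto
    then have "(m choose j)\<^sup>2 \<le> (2 * ((2 * n) choose n))\<^sup>2" by (intro power_mono) auto
    then have "m * (m choose j)\<^sup>2 \<le> m * (2 * ((2 * n) choose n))\<^sup>2" by (rule mult_left_mono) simp
    also have "\<dots> = 4 * ((2 * n + 1) * ((2 * n) choose n)\<^sup>2)" by (simp add: 2 power_mult_distrib)
    also have "\<dots> \<le> 4 * 16 ^ n" by (intro mult_left_mono central_binomial_square_le) auto
    finally show ?thesis by (simp add: 2 power_mult)
  qed
qed

lemma binomial_over_power_tendsto_0:
  "(\<lambda>N. real ((N - 1) choose (f N)) / 2 ^ N) \<longlonglongrightarrow> 0"
proof (rule Lim_null_comparison)
  show "(\<lambda>N. 1 / sqrt (real (N - 1))) \<longlonglongrightarrow> 0" by real_asymp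
  show "\<forall>\<^sub>F N in sequentially. norm (real ((N - 1) choose (f N)) / 2 ^ N) \<le> 1 / sqrt (real (N - 1))"
    using eventually_ge_at_top[of 2]
  proof eventually_elim
    case (elim N)
    define m where "m = N - 1"
    have m: "N = Suc m" "0 < m" using elim by (auto simp: m_def)
    have "real (m * (m choose f N)\<^sup>2) \<le> real (4 ^ m)"
      using binomial_square_le[of m "f N"] by (simp only: of_nat_le_iff)
    then have "(sqrt (real m) * real (m choose f N))\<^sup>2 \<le> (2 ^ m)\<^sup>2"
      by (simp add: power_mult_distrib flip: power_mult)
         (simp add: power_mult mult.commute[of _ 2])
    then have "sqrt (real m) * real (m choose f N) \<le> 2 ^ m"
      by (rule power2_le_imp_le) simp
    then have "real (m choose f N) / 2 ^ m \<le> 1 / sqrt (real m)"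
      using m by (simp add: field_simps)
    moreover have "real (m choose f N) / 2 ^ N \<le> real (m choose f N) / 2 ^ m"
      unfolding m by (intro divide_left_mono) auto
    ultimately show ?case by (simp add: m_def)
  qed
qed

section \<open>Rates of success for a given number of voters\<close>

lemma sum_Pow_card:
  fixes g :: "nat \<Rightarrow> real"
  assumes "finite W"
  shows "(\<Sum>B\<in>Pow W. g (card B)) = (\<Sum>k\<le>card W. real (card W choose k) * g k)"
proof -
  have "(\<Sum>B\<in>Pow W. g (card B)) = (\<Sum>k\<le>card W. \<Sum>B | B \<in> Pow W \<and> card B = k. g (card B))"
    using assms by (intro sum.group[symmetric]) (auto intro: card_mono)
  also have "\<dots> = (\<Sum>k\<le>card W. real (card W choose k) * g k)"
    using n_subsets[OF assms] by (intro sum.cong) auto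
  finally show ?thesis .
qed

text \<open>
  A voter \<open>v\<close> among \<open>m\<close> others, where a coalition needs \<open>j + 1\<close> members to win. The offsets
  are chosen so that \<open>v\<close> is pivotal exactly for groups of \<open>j\<close> of the \<open>m\<close> others.
\<close>

locale unit_weight_game =
  fixes V :: "'a set" and v :: 'a and m :: nat and j :: nat
  assumes finite_V: "finite V" and voter: "v \<in> V"
    and card_V: "card V = Suc m" and threshold_le: "j \<le> m"
begin

definition winning :: "'a set set" where
  "winning = {A. A \<subseteq> V \<and> Suc j \<le> card A}"

lemma finite_others: "finite (V - {v})" and card_others: "card (V - {v}) = m"
  using finite_V voter card_V by auto

text \<open>
  Removing the voter is a bijection onto the coalitions of at least \<open>j\<close> other voters.
\<close>

lemma sum_winning_with_voter:
  fixes g :: "nat \<Rightarrow> real"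
  shows "(\<Sum>A | A \<in> winning \<and> v \<in> A. g (card A)) = (\<Sum>k=j..m. real (m choose k) * g (Suc k))"
proof -
  have "(\<Sum>A | A \<in> winning \<and> v \<in> A. g (card A))
      = (\<Sum>B | B \<subseteq> V - {v} \<and> j \<le> card B. g (Suc (card B)))"
  proof (rule sum.reindex_bij_witness[of _ "insert v" "\<lambda>A. A - {v}"])
    fix A assume "A \<in> {A \<in> winning. v \<in> A}"
    then have A: "A \<subseteq> V" "v \<in> A" "Suc j \<le> card A" by (auto simp: winning_def)
    then have "finite A" using finite_V finite_subset by blast
    then have "Suc (card (A - {v})) = card A" using A by (intro card_Suc_Diff1)
    then show "g (Suc (card (A - {v}))) = g (card A)" by (rule arg_cong)
    have "j \<le> card (A - {v})" using \<open>Suc (card (A - {v})) = card A\<close> A(3) by linarith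
    then show "A - {v} \<in> {B. B \<subseteq> V - {v} \<and> j \<le> card B}" using A(1) by blast
    show "insert v (A - {v}) = A" using A(2) by blast
  next
    fix B assume "B \<in> {B. B \<subseteq> V - {v} \<and> j \<le> card B}"
    then have B: "B \<subseteq> V - {v}" "j \<le> card B" by auto
    then have "finite B" using finite_V finite_subset by blast
    then show "insert v B \<in> {A \<in> winning. v \<in> A}" "insert v B - {v} = B"
      using B voter by (auto simp: winning_def card_insert_if)
  qed
  also have "\<dots> = (\<Sum>B\<in>Pow (V - {v}). if j \<le> card B then g (Suc (card B)) else 0)"
    using finite_others by (intro sum.mono_neutral_cong_left) auto
  also have "\<dots> = (\<Sum>k\<le>m. real (m choose k) * (if j \<le> k then g (Suc k) else 0))"
    using sum_Pow_card[OF finite_others, of "\<lambda>k. if j \<le> k then g (Suc k) else 0"]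
    by (simp add: card_others)
  also have "\<dots> = (\<Sum>k=j..m. real (m choose k) * g (Suc k))"
    by (intro sum.mono_neutral_cong_right) auto
  finally show ?thesis .
qed

lemma sum_losing_without_voter:
  fixes g :: "nat \<Rightarrow> real"
  shows "(\<Sum>A | A \<subseteq> V \<and> A \<notin> winning \<and> v \<notin> A. g (card A)) = (\<Sum>k\<le>j. real (m choose k) * g k)"
proof -
  have "(\<Sum>A | A \<subseteq> V \<and> A \<notin> winning \<and> v \<notin> A. g (card A))
      = (\<Sum>B\<in>Pow (V - {v}). if card B \<le> j then g (card B) else 0)"
    using finite_others by (intro sum.mono_neutral_cong_left) (auto simp: winning_def)
  also have "\<dots> = (\<Sum>k\<le>m. real (m choose k) * (if k \<le> j then g k else 0))"
    using sum_Pow_card[OF finite_others, of "\<lambda>k. if k \<le> j then g k else 0"]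
    by (simp add: card_others)
  also have "\<dots> = (\<Sum>k\<le>j. real (m choose k) * g k)"
    using threshold_le by (intro sum.mono_neutral_cong_right) auto
  finally show ?thesis .
qed

lemma affirmative_success_penrose_banzhaf:
  "affirmative_success (penrose_banzhaf V) winning v = (\<Sum>k=j..m. real (m choose k)) / 2 ^ Suc m"
  using sum_winning_with_voter[of "\<lambda>_. 1"] unfolding affirmative_success_def
  by (subst measure_penrose_banzhaf) (auto simp: finite_V card_V winning_def)

lemma blocking_success_penrose_banzhaf:
  "blocking_success (penrose_banzhaf V) V winning v = (\<Sum>k\<le>j. real (m choose k)) / 2 ^ Suc m"
  using sum_losing_without_voter[of "\<lambda>_. 1"] unfolding blocking_success_def
  by (subst measure_penrose_banzhaf) (auto simp: finite_V card_V)

text \<open>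
  The excess over \<open>1/2\<close> is half the probability that the voter is pivotal: the sizes
  \<open>{j..m}\<close> and \<open>{..j}\<close> of the groups of other voters overlap in \<open>j\<close>.
\<close>

lemma success_penrose_banzhaf:
  "success (penrose_banzhaf V) V winning v = 1 / 2 + real (m choose j) / 2 ^ Suc m"
proof -
  have "(\<Sum>k=j..m. real (m choose k)) + (\<Sum>k\<le>j. real (m choose k))
      = (\<Sum>k\<in>{j..m} \<union> {..j}. real (m choose k)) + (\<Sum>k\<in>{j..m} \<inter> {..j}. real (m choose k))"
    by (intro sum.union_inter[symmetric]) auto
  also have "{j..m} \<union> {..j} = {..m}"
    using threshold_le by auto
  also have "{j..m} \<inter> {..j} = {j}"
    using threshold_le by auto
  also have "(\<Sum>k\<le>m. real (m choose k)) = 2 ^ m"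
    by (metis choose_row_sum of_nat_sum of_nat_power of_nat_numeral)
  finally show ?thesis
    unfolding success_def affirmative_success_penrose_banzhaf blocking_success_penrose_banzhaf
    by (simp add: field_simps)
qed

text \<open>
  By absorption, \<open>binom(m, k) / binom(m + 1, k + 1) = (k + 1) / (m + 1)\<close>, so the summands
  are linear in the size of the coalition.
\<close>

lemma affirmative_success_shapley_shubik:
  "affirmative_success (shapley_shubik V) winning v
    = (real (m + 1) * (real m + 2) - real j * (real j + 1)) / (2 * real (m + 1) * (real m + 2))"
proof -
  have "affirmative_success (shapley_shubik V) winning v
      = (\<Sum>k=j..m. real (m choose k) * (1 / (real (Suc m) + 1) * (1 / real (Suc m choose Suc k))))"
    unfolding affirmative_success_def
    by (subst measure_shapley_shubik)
       (use sum_winning_with_voter[of "\<lambda>k. 1 / (real (Suc m) + 1) * (1 / real (Suc m choose k))"]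
        in \<open>auto simp: finite_V card_V winning_def simp del: binomial_Suc_Suc\<close>)
  also have "\<dots> = (\<Sum>k=j..m. real (Suc k)) / (real (m + 1) * (real m + 2))"
    unfolding sum_divide_distrib
  proof (rule sum.cong)
    fix k assume "k \<in> {j..m}"
    then have "real (Suc m choose Suc k) > 0" by (simp del: binomial_Suc_Suc)
    moreover have "real (Suc k) * real (Suc m choose Suc k) = real (Suc m) * real (m choose k)"
      by (metis Suc_times_binomial of_nat_mult)
    ultimately have "real (m choose k) / real (Suc m choose Suc k) = real (Suc k) / real (Suc m)"
      by (simp add: frac_eq_eq mult.commute del: binomial_Suc_Suc of_nat_Suc)
    moreover have "real (m choose k) * (1 / (real (Suc m) + 1) * (1 / real (Suc m choose Suc k)))
        = real (m choose k) / real (Suc m choose Suc k) / (real m + 2)"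
      by (simp add: add_ac del: binomial_Suc_Suc)
    ultimately show "real (m choose k) * (1 / (real (Suc m) + 1) * (1 / real (Suc m choose Suc k)))
        = real (Suc k) / (real (m + 1) * (real m + 2))"
      by (simp only: divide_divide_eq_left Suc_eq_plus1)
  qed simp
  also have "(\<Sum>k=j..m. real (Suc k)) = (real (m + 1) * (real m + 2) - real j * (real j + 1)) / 2"
    using threshold_le by (induction m rule: dec_induct) (auto simp: field_simps)
  finally show ?thesis by (simp add: mult.assoc)
qed

text \<open>
  Here absorption takes the form \<open>binom(m, k) / binom(m + 1, k) = (m + 1 - k) / (m + 1)\<close>.
\<close>

lemma blocking_success_shapley_shubik:
  "blocking_success (shapley_shubik V) V winning v
    = (2 * real (m + 1) * real (j + 1) - real j * (real j + 1)) / (2 * real (m + 1) * (real m + 2))"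
proof -
  have "blocking_success (shapley_shubik V) V winning v
      = (\<Sum>k\<le>j. real (m choose k) * (1 / (real (Suc m) + 1) * (1 / real (Suc m choose k))))"
    unfolding blocking_success_def
    by (subst measure_shapley_shubik)
       (use sum_losing_without_voter[of "\<lambda>k. 1 / (real (Suc m) + 1) * (1 / real (Suc m choose k))"]
        in \<open>auto simp: finite_V card_V\<close>)
  also have "\<dots> = (\<Sum>k\<le>j. real (Suc m) - real k) / (real (m + 1) * (real m + 2))"
    unfolding sum_divide_distrib
  proof (rule sum.cong)
    fix k assume "k \<in> {..j}"
    then have k: "k \<le> m" using threshold_le by simp
    then have "real (Suc m choose k) > 0" by simp
    moreover have "(real (Suc m) - real k) * real (Suc m choose k) = real (Suc m) * real (m choose k)"
      using arg_cong[OF binomial_absorb_comp[of "Suc m" k], of real] k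
      by (simp only: of_nat_mult of_nat_diff[OF le_SucI] diff_Suc_1)
    ultimately have "real (m choose k) / real (Suc m choose k) = (real (Suc m) - real k) / real (Suc m)"
      by (simp add: frac_eq_eq mult.commute del: of_nat_Suc)
    moreover have "real (m choose k) * (1 / (real (Suc m) + 1) * (1 / real (Suc m choose k)))
        = real (m choose k) / real (Suc m choose k) / (real m + 2)"
      by (simp add: add_ac)
    ultimately show "real (m choose k) * (1 / (real (Suc m) + 1) * (1 / real (Suc m choose k)))
        = (real (Suc m) - real k) / (real (m + 1) * (real m + 2))"
      by (simp only: divide_divide_eq_left Suc_eq_plus1)
  qed simp
  also have "(\<Sum>k\<le>j. real (Suc m) - real k) = (2 * real (m + 1) * real (j + 1) - real j * (real j + 1)) / 2"
    by (induction j) (auto simp: field_simps)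
  finally show ?thesis by (simp add: mult.assoc)
qed

end

text \<open>
  Sizes are integers, so the real threshold \<open>r N\<close> may be rounded up. The bounds on \<open>r\<close> place
  the rounded threshold in \<open>{1..N}\<close>, which makes the subtractions below exact.
\<close>

lemma unit_weights_winning_coalitions:
  assumes W: "weighted_voting_system V \<V> (\<lambda>_. 1) r" and V: "card V = N" "v \<in> V"
  defines "t \<equiv> nat \<lceil>r * real N\<rceil>"
  shows "unit_weight_game V v (N - 1) (t - 1)"
    and "\<V> = unit_weight_game.winning V (t - 1)"
    and "1 \<le> t" and "t \<le> N"
proof -
  interpret weighted_voting_system V \<V> "\<lambda>_. 1" r by (rule W)
  have N: "0 < N" using V finite_voters by (auto simp: card_gt_0_iff)
  have r: "0 < r" "r \<le> 1" using unit_weights_quota[OF W] by auto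
  then have "0 < r * real N" "r * real N \<le> real N" using N by (simp_all add: mult_left_le_one_le)
  then show t1: "1 \<le> t" and t: "t \<le> N" unfolding t_def by linarith+
  show *: "unit_weight_game V v (N - 1) (t - 1)"
    using finite_voters V N t t1 by unfold_locales auto
  have "real k \<ge> r * real N \<longleftrightarrow> t \<le> k" for k unfolding t_def by linarith
  then have "A \<in> \<V> \<longleftrightarrow> A \<subseteq> V \<and> Suc (t - 1) \<le> card A" for A
    using coalitions unit_weights_winning_iff[OF W, of A] V t1 by auto
  then show "\<V> = unit_weight_game.winning V (t - 1)"
    unfolding unit_weight_game.winning_def[OF *] by blast
qed

section \<open>The limit of many voters\<close>

theorem theorem4p7:
  fixes V :: "nat \<Rightarrow> 'a set" and \<V> :: "nat \<Rightarrow> 'a set set"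
    and v :: "nat \<Rightarrow> 'a" and r :: real
  assumes "\<And>N. N \<ge> 1 \<Longrightarrow> weighted_voting_system (V N) (\<V> N) (\<lambda>_. 1) r"
    and "\<And>N. N \<ge> 1 \<Longrightarrow> card (V N) = N"
    and "\<And>N. N \<ge> 1 \<Longrightarrow> v N \<in> V N"
  shows
    "((\<lambda>N. success (penrose_banzhaf (V N)) (V N) (\<V> N) (v N)) \<longlonglongrightarrow> 1 / 2) \<and>
     (r > 1 / 2 \<longrightarrow>
       (\<forall>N\<ge>1. affirmative_success (penrose_banzhaf (V N)) (\<V> N) (v N)
                \<le> 1 / 2 * exp (- 2 * (r - 1 / 2)\<^sup>2 * (real N - 1)))) \<and>
     ((\<lambda>N. affirmative_success (shapley_shubik (V N)) (\<V> N) (v N))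
        \<longlonglongrightarrow> 1 / 2 - 1 / 2 * r\<^sup>2) \<and>
     ((\<lambda>N. blocking_success (shapley_shubik (V N)) (V N) (\<V> N) (v N))
        \<longlonglongrightarrow> 1 / 2 - 1 / 2 * (1 - r)\<^sup>2) \<and>
     ((\<lambda>N. success (shapley_shubik (V N)) (V N) (\<V> N) (v N))
        \<longlonglongrightarrow> 1 - 1 / 2 * (r\<^sup>2 + (1 - r)\<^sup>2))"
proof -
  define t where "t N = nat \<lceil>r * real N\<rceil>" for N
  \<comment> \<open>The relative threshold; both Shapley-Shubik rates are rational functions of \<open>x N\<close> and \<open>1 / N\<close>.\<close>
  define x where "x N = real (t N) / real N" for N
  have game: "unit_weight_game (V N) (v N) (N - 1) (t N - 1)"
    and winning: "\<V> N = unit_weight_game.winning (V N) (t N - 1)"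
    and t: "1 \<le> t N" "t N \<le> N" if "N \<ge> 1" for N
    unfolding t_def using unit_weights_winning_coalitions[OF assms[OF that]] by auto
  have t_ge: "r * real N \<le> real (t N)" for N
    unfolding t_def by linarith
  have t_le: "real (t N) \<le> r * real N + 1" if "N \<ge> 1" for N
    using t(1)[OF that] unfolding t_def by linarith
  have pred: "real (N - 1) = real N - 1" "real (t N - 1) = real (t N) - 1" if "N \<ge> 1" for N
    using that t(1)[OF that] by auto
  have shift: "real N - 1 + 2 = real N + 1" for N by simp
  have pow: "(2 :: real) ^ Suc (N - 1) = 2 * 2 ^ (N - 1)" "(2 :: real) * 2 ^ (N - 1) = 2 ^ N"
    if "N \<ge> 1" for N
    using that by (cases N; simp)+
  have x_lim: "x \<longlonglongrightarrow> r"
  proof (rule tendsto_sandwich)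
    show "\<forall>\<^sub>F N in sequentially. r \<le> x N" "\<forall>\<^sub>F N in sequentially. x N \<le> r + 1 / real N"
      using eventually_ge_at_top[of 1]
      by (eventually_elim; use t_ge t_le in \<open>simp add: x_def field_simps\<close>)+
    show "(\<lambda>N. r + 1 / real N) \<longlonglongrightarrow> r" by real_asymp
  qed simp
  have inv_lim: "(\<lambda>N. 1 / real N) \<longlonglongrightarrow> 0" by real_asymp

  have banzhaf: "(\<lambda>N. success (penrose_banzhaf (V N)) (V N) (\<V> N) (v N)) \<longlonglongrightarrow> 1 / 2"
  proof (rule Lim_transform_eventually)
    show "(\<lambda>N. 1 / 2 + real ((N - 1) choose (t N - 1)) / 2 ^ N) \<longlonglongrightarrow> 1 / 2"
      using tendsto_add[OF tendsto_const binomial_over_power_tendsto_0] by simp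
    show "\<forall>\<^sub>F N in sequentially. 1 / 2 + real ((N - 1) choose (t N - 1)) / 2 ^ N
        = success (penrose_banzhaf (V N)) (V N) (\<V> N) (v N)"
      using eventually_ge_at_top[of 1]
      by eventually_elim
        (simp only: winning unit_weight_game.success_penrose_banzhaf[OF game] pow)
  qed

  have banzhaf_le: "affirmative_success (penrose_banzhaf (V N)) (\<V> N) (v N)
      \<le> 1 / 2 * exp (- 2 * (r - 1 / 2)\<^sup>2 * (real N - 1))" if r: "r > 1 / 2" and N: "N \<ge> 1" for N
  proof -
    have xr: "r \<le> x N" using t_ge[of N] N by (simp add: x_def field_simps)
    have "1 / 2 * real N < r * real N" using r N by (intro mult_strict_right_mono) auto
    \<comment> \<open>The threshold is a strict majority, so the tail estimate is within its range.\<close>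
    then have half: "N < 2 * t N" using t_ge[of N] by linarith
    have "affirmative_success (penrose_banzhaf (V N)) (\<V> N) (v N)
        = 1 / 2 * ((\<Sum>k=t N - 1..N - 1. real ((N - 1) choose k)) / 2 ^ (N - 1))"
      using N by (simp only: winning unit_weight_game.affirmative_success_penrose_banzhaf[OF game] pow(1))
    also have "\<dots> \<le> 1 / 2 * exp (- real (N - 1) / (real (N - 1) + 1)\<^sup>2
        * (2 * real (t N - 1) + 1 - real (N - 1))\<^sup>2 / 2)"
    proof -
      have "t N - 1 \<le> N - 1" "N - 1 \<le> 2 * (t N - 1) + 1" using t[OF N] half by linarith+
      from binomial_tail_le[OF this] show ?thesis by (simp add: divide_le_eq mult.commute)
    qed
    also have "- real (N - 1) / (real (N - 1) + 1)\<^sup>2 * (2 * real (t N - 1) + 1 - real (N - 1))\<^sup>2 / 2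
        = - 2 * (x N - 1 / 2)\<^sup>2 * (real N - 1)"
    proof -
      have "x N - 1 / 2 = (2 * real (t N) - real N) / (2 * real N)"
        using N by (simp add: x_def field_simps)
      moreover have "2 * (real (t N) - 1) + 1 - (real N - 1) = 2 * real (t N) - real N"
        "real N - 1 + 1 = real N" by simp_all
      moreover have rearrange: "- a / b * d / 2 = - 2 * (d / (2\<^sup>2 * b)) * a" for a b d :: real
        by (simp add: mult.commute)
      ultimately show ?thesis
        by (simp only: pred[OF N] power_divide power_mult_distrib rearrange)
    qed
    also have "\<dots> \<le> - 2 * (r - 1 / 2)\<^sup>2 * (real N - 1)"
      using xr r N by (simp add: mult_right_mono power_mono)
    finally show ?thesis by simp
  qed

  have shapley_plus: "(\<lambda>N. affirmative_success (shapley_shubik (V N)) (\<V> N) (v N))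
      \<longlonglongrightarrow> 1 / 2 - 1 / 2 * r\<^sup>2"
  proof (rule Lim_transform_eventually)
    have "(\<lambda>N. 1 / 2 - x N * (x N - 1 / real N) / (2 * (1 + 1 / real N)))
        \<longlonglongrightarrow> 1 / 2 - r * (r - 0) / (2 * (1 + 0))"
      by (intro tendsto_intros x_lim inv_lim) auto
    then show "(\<lambda>N. 1 / 2 - x N * (x N - 1 / real N) / (2 * (1 + 1 / real N)))
        \<longlonglongrightarrow> 1 / 2 - 1 / 2 * r\<^sup>2"
      by (simp add: power2_eq_square)
    show "\<forall>\<^sub>F N in sequentially. 1 / 2 - x N * (x N - 1 / real N) / (2 * (1 + 1 / real N))
        = affirmative_success (shapley_shubik (V N)) (\<V> N) (v N)"
      using eventually_ge_at_top[of 1]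
    proof eventually_elim
      case (elim N)
      have "1 / 2 - x N * (x N - 1 / real N) / (2 * (1 + 1 / real N))
          = (real N * (real N + 1) - (real (t N) - 1) * real (t N)) / (2 * real N * (real N + 1))"
        using elim unfolding x_def by (simp add: divide_simps) (simp add: algebra_simps)
      also have "\<dots> = affirmative_success (shapley_shubik (V N)) (\<V> N) (v N)"
        by (simp only: winning[OF elim] unit_weight_game.affirmative_success_shapley_shubik[OF game[OF elim]]
            pred[OF elim] shift of_nat_add of_nat_1 diff_add_cancel)
      finally show ?case .
    qed
  qed

  have shapley_minus: "(\<lambda>N. blocking_success (shapley_shubik (V N)) (V N) (\<V> N) (v N))
      \<longlonglongrightarrow> 1 / 2 - 1 / 2 * (1 - r)\<^sup>2"
  proof (rule Lim_transform_eventually)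
    have "(\<lambda>N. (2 * x N - x N * (x N - 1 / real N)) / (2 * (1 + 1 / real N)))
        \<longlonglongrightarrow> (2 * r - r * (r - 0)) / (2 * (1 + 0))"
      by (intro tendsto_intros x_lim inv_lim) auto
    then show "(\<lambda>N. (2 * x N - x N * (x N - 1 / real N)) / (2 * (1 + 1 / real N)))
        \<longlonglongrightarrow> 1 / 2 - 1 / 2 * (1 - r)\<^sup>2"
      by (simp add: power2_eq_square field_simps)
    show "\<forall>\<^sub>F N in sequentially. (2 * x N - x N * (x N - 1 / real N)) / (2 * (1 + 1 / real N))
        = blocking_success (shapley_shubik (V N)) (V N) (\<V> N) (v N)"
      using eventually_ge_at_top[of 1]
    proof eventually_elim
      case (elim N)
      have "(2 * x N - x N * (x N - 1 / real N)) / (2 * (1 + 1 / real N))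
          = (2 * real N * real (t N) - (real (t N) - 1) * real (t N)) / (2 * real N * (real N + 1))"
        using elim unfolding x_def by (simp add: divide_simps)
      also have "\<dots> = blocking_success (shapley_shubik (V N)) (V N) (\<V> N) (v N)"
        by (simp only: winning[OF elim] unit_weight_game.blocking_success_shapley_shubik[OF game[OF elim]]
            pred[OF elim] shift of_nat_add of_nat_1 diff_add_cancel)
      finally show ?case .
    qed
  qed

  have "(\<lambda>N. success (shapley_shubik (V N)) (V N) (\<V> N) (v N))
      \<longlonglongrightarrow> (1 / 2 - 1 / 2 * r\<^sup>2) + (1 / 2 - 1 / 2 * (1 - r)\<^sup>2)"
    unfolding success_def by (intro tendsto_add shapley_plus shapley_minus)
  moreover have "(1 / 2 - 1 / 2 * r\<^sup>2) + (1 / 2 - 1 / 2 * (1 - r)\<^sup>2) = 1 - 1 / 2 * (r\<^sup>2 + (1 - r)\<^sup>2)"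
    by (simp add: algebra_simps)
  ultimately show ?thesis
    using banzhaf banzhaf_le shapley_plus shapley_minus by (intro conjI impI allI) (simp_all only:)
qed

end
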